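(* Let $(G,\tau)$ be a topological abelian group and $\phi:(G,\tau)\to(G,\tau)$ a continuous endomorphism. Then $$\mathrm{ent}^\star_\tau(\phi)=\mathrm{ent}^\star_{\tau_\lambda}(\phi)=\mathrm{ent}^\star_{\tau^+}(\phi)=\mathrm{ent}^\star_{\tau_\lambda^+}(\phi).$$
   Context: Topological groups are not assumed Hausdorff. For an abelian group $G$, let $\mathcal C(G)$ be the family of all finite-index subgroups of $G$. For an endomorphism $\phi$ of $G$, $N\in\mathcal C(G)$ and an integer $n\ge 1$, let $B_n(\phi,N)=N\cap\phi^{-1}(N)\cap\ldots\cap\phi^{-n+1}(N)$, $C_n(\phi,N)=G/B_n(\phi,N)$ (a finite group), and $H^\star(\phi,N)=\lim_{n\to\infty}\frac{\log|C_n(\phi,N)|}{n}$ (the limit exists and is finite). For a topological abelian group $(G,\tau)$ let $\mathcal C_\tau(G)=\{N\in\mathcal C(G): N \text{ is } \tau\text{-open}\}$. The topological adjoint entropy of a continuous endomorphism $\phi:(G,\tau)\to(G,\tau)$ is $\mathrm{ent}^\star_\tau(\phi)=\sup\{H^\star(\phi,N):N\in\mathcal C_\tau(G)\}\in[0,\infty]$. A group topology is totally bounded if for every open neighborhood $U$ of $0$ there is a finite $F\subseteq G$ with $U+F=G$. The Bohr modification $\tau^+$ of $\tau$ is the finest totally bounded group topology on $G$ coarser than $\tau$. The linear modification $\tau_\lambda$ of $\tau$ is the group topology on $G$ having all $\tau$-open subgroups of $G$ as a base of neighborhoods of $0$. Finally $\tau_\lambda^+:=(\tau^+)_\lambda$;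 equivalently, it is the group topology on $G$ having $\mathcal C_\tau(G)$ as a base of neighborhoods of $0$. If $\phi$ is $\tau$-continuous then it is continuous for each of $\tau_\lambda,\tau^+,\tau_\lambda^+$. *)

theory Defs
  imports "HOL-Analysis.Analysis" "HOL-Algebra.Coset"
begin

text \<open>
  Abelian groups are written multiplicatively, following HOL-Algebra. A topology on \<open>G\<close> is a
  value of type \<open>'a topology\<close> whose underlying set is \<open>carrier G\<close>, so that several topologies on
  the same group can be compared. No separation axiom is assumed.
\<close>

definition group_topology :: "('a, 'b) monoid_scheme \<Rightarrow> 'a topology \<Rightarrow> bool" where
  "group_topology G T \<longleftrightarrow>
     topspace T = carrier G \<and>
     continuous_map (prod_topology T T) T (\<lambda>(x, y). x \<otimes>\<^bsub>G\<^esub> y) \<and>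
     continuous_map T T (\<lambda>x. inv\<^bsub>G\<^esub> x)"

definition coarser_topology :: "'a topology \<Rightarrow> 'a topology \<Rightarrow> bool" where
  "coarser_topology S T \<longleftrightarrow> (\<forall>U. openin S U \<longrightarrow> openin T U)"

definition finite_index_subgroups :: "('a, 'b) monoid_scheme \<Rightarrow> 'a set set" where
  "finite_index_subgroups G = {N. subgroup N G \<and> finite (rcosets\<^bsub>G\<^esub> N)}"

definition open_finite_index_subgroups ::
    "('a, 'b) monoid_scheme \<Rightarrow> 'a topology \<Rightarrow> 'a set set" where
  "open_finite_index_subgroups G T = {N \<in> finite_index_subgroups G. openin T N}"

definition cotrajectory ::
    "('a, 'b) monoid_scheme \<Rightarrow> ('a \<Rightarrow> 'a) \<Rightarrow> 'a set \<Rightarrow> nat \<Rightarrow> 'a set" where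
  "cotrajectory G \<phi> N n = carrier G \<inter> (\<Inter>i<n. (\<phi> ^^ i) -` N)"

text \<open>
  The sequence below converges for every endomorphism \<open>\<phi>\<close> of an abelian group and every
  finite-index subgroup \<open>N\<close>; the (junk) term at \<open>n = 0\<close> does not affect the limit.
\<close>

definition adjoint_entropy_wrt ::
    "('a, 'b) monoid_scheme \<Rightarrow> ('a \<Rightarrow> 'a) \<Rightarrow> 'a set \<Rightarrow> real" where
  "adjoint_entropy_wrt G \<phi> N =
     lim (\<lambda>n. ln (real (order (G Mod cotrajectory G \<phi> N n))) / real n)"

definition top_adjoint_entropy ::
    "('a, 'b) monoid_scheme \<Rightarrow> 'a topology \<Rightarrow> ('a \<Rightarrow> 'a) \<Rightarrow> ereal" where
  "top_adjoint_entropy G T \<phi> =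
     (SUP N\<in>open_finite_index_subgroups G T. ereal (adjoint_entropy_wrt G \<phi> N))"

definition totally_bounded_topology :: "('a, 'b) monoid_scheme \<Rightarrow> 'a topology \<Rightarrow> bool" where
  "totally_bounded_topology G T \<longleftrightarrow>
     (\<forall>U. openin T U \<and> \<one>\<^bsub>G\<^esub> \<in> U \<longrightarrow>
        (\<exists>F. finite F \<and> F \<subseteq> carrier G \<and> U <#>\<^bsub>G\<^esub> F = carrier G))"

definition is_bohr_modification ::
    "('a, 'b) monoid_scheme \<Rightarrow> 'a topology \<Rightarrow> 'a topology \<Rightarrow> bool" where
  "is_bohr_modification G T S \<longleftrightarrow>
     group_topology G S \<and> totally_bounded_topology G S \<and> coarser_topology S T \<and>
     (\<forall>R. group_topology G R \<and> totally_bounded_topology G R \<and> coarser_topology R T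
          \<longrightarrow> coarser_topology R S)"

definition bohr_modification ::
    "('a, 'b) monoid_scheme \<Rightarrow> 'a topology \<Rightarrow> 'a topology" where
  "bohr_modification G T = (THE S. is_bohr_modification G T S)"

text \<open>
  The library predicate \<^const>\<open>neighbourhood_base_at\<close> only says that every neighbourhood of the
  point contains a neighbourhood from the family; that every member of the family is a
  neighbourhood has to be required separately.
\<close>

definition has_nhd_base_at :: "'a topology \<Rightarrow> 'a \<Rightarrow> 'a set set \<Rightarrow> bool" where
  "has_nhd_base_at T x \<B> \<longleftrightarrow>
     (\<forall>N\<in>\<B>. N \<subseteq> topspace T \<and> (\<exists>U. openin T U \<and> x \<in> U \<and> U \<subseteq> N)) \<and>
     neighbourhood_base_at x (\<lambda>N. N \<in> \<B>) T"

definition linear_modification ::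
    "('a, 'b) monoid_scheme \<Rightarrow> 'a topology \<Rightarrow> 'a topology" where
  "linear_modification G T =
     (THE S. group_topology G S \<and> has_nhd_base_at S \<one>\<^bsub>G\<^esub> {N. subgroup N G \<and> openin T N})"

end

theory Submission
  imports Defs
begin

text \<open>
  All four topologies have the same open subgroups of finite index. A subgroup is open as soon as
  it is a neighbourhood of the identity, which settles the linear modifications. The Bohr
  modification is realised concretely: its neighbourhoods of the identity form the largest family
  of open sets that are covered by finitely many translates and can be ``halved'' inside the family.
  An open subgroup of finite index halves itself, so it belongs to that family.
\<close>

context comm_group
begin

section \<open>Group topologies built from a neighbourhood base at the identity\<close>

text \<open>\<open>topology\<close> is an abstraction function, so the predicate describes the open
  sets only once it is known to satisfy \<open>istopology\<close>. For a
  \<open>group_nhd_base\<close> this is established in \<open>openin_nhds_topology\<close>.\<close>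

definition nhds_topology :: "'a set set \<Rightarrow> 'a topology" where
  "nhds_topology \<B> = topology (\<lambda>U. U \<subseteq> carrier G \<and> (\<forall>x\<in>U. \<exists>N\<in>\<B>. x <# N \<subseteq> U))"

text \<open>These are the classical axioms for a base of identity neighbourhoods of a group topology
  on an abelian group. The quotient condition encodes continuity of multiplication and inversion at
  once. Members are meant as neighbourhoods and may fail to be open.\<close>

definition group_nhd_base :: "'a set set \<Rightarrow> bool" where
  "group_nhd_base \<B> \<longleftrightarrow> \<B> \<noteq> {} \<and> (\<forall>N\<in>\<B>. \<one> \<in> N \<and> N \<subseteq> carrier G) \<and>
     (\<forall>M\<in>\<B>. \<forall>N\<in>\<B>. \<exists>L\<in>\<B>. L \<subseteq> M \<inter> N) \<and>
     (\<forall>N\<in>\<B>. \<exists>M\<in>\<B>. \<forall>a\<in>M. \<forall>b\<in>M. a \<otimes> inv b \<in> N)"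

lemma group_nhd_base_inv:
  assumes "group_nhd_base \<B>" "N \<in> \<B>"
  obtains M where "M \<in> \<B>" "\<And>b. b \<in> M \<Longrightarrow> inv b \<in> N"
proof -
  obtain M where M: "M \<in> \<B>" "\<forall>a\<in>M. \<forall>b\<in>M. a \<otimes> inv b \<in> N" and sub: "\<one> \<in> M" "M \<subseteq> carrier G"
    using assms unfolding group_nhd_base_def by meson
  have "inv b \<in> N" if "b \<in> M" for b
  proof -
    have "\<one> \<otimes> inv b \<in> N" using M sub that by blast
    then show ?thesis using sub that by auto
  qed
  then show thesis using that M by blast
qed

text \<open>A product is a quotient, \<open>a \<otimes> inv (inv b)\<close>. So \<open>M\<close> is
  taken inside a set \<open>K\<close> whose quotients lie in \<open>N\<close> and inside a set
  \<open>L\<close> whose inverses lie in \<open>K\<close>.\<close>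

lemma group_nhd_base_mult:
  assumes "group_nhd_base \<B>" "N \<in> \<B>"
  obtains M where "M \<in> \<B>" "\<And>a b. a \<in> M \<Longrightarrow> b \<in> M \<Longrightarrow> a \<otimes> b \<in> N"
proof -
  obtain K where K: "K \<in> \<B>" "\<forall>a\<in>K. \<forall>b\<in>K. a \<otimes> inv b \<in> N"
    using assms unfolding group_nhd_base_def by meson
  obtain L where L: "L \<in> \<B>" "\<And>b. b \<in> L \<Longrightarrow> inv b \<in> K"
    using group_nhd_base_inv[OF assms(1) K(1)] by blast
  obtain M where M: "M \<in> \<B>" "M \<subseteq> K \<inter> L"
    using assms(1) K(1) L(1) unfolding group_nhd_base_def by meson
  have MG: "M \<subseteq> carrier G"
    using M assms(1) unfolding group_nhd_base_def by blast
  have "a \<otimes> b \<in> N" if "a \<in> M" "b \<in> M" for a b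
  proof -
    have "a \<otimes> inv (inv b) \<in> N" using K L M that by blast
    then show ?thesis using MG that by auto
  qed
  then show thesis using that M by blast
qed

lemma openin_nhds_topology:
  assumes "group_nhd_base \<B>"
  shows "openin (nhds_topology \<B>) U \<longleftrightarrow> U \<subseteq> carrier G \<and> (\<forall>x\<in>U. \<exists>N\<in>\<B>. x <# N \<subseteq> U)"
proof -
  let ?P = "\<lambda>U. U \<subseteq> carrier G \<and> (\<forall>x\<in>U. \<exists>N\<in>\<B>. x <# N \<subseteq> U)"
  have "istopology ?P"
    unfolding istopology_def
  proof (intro conjI allI impI)
    fix S T assume S: "?P S" and T: "?P T"
    show "S \<inter> T \<subseteq> carrier G" using S by blast
    show "\<forall>x\<in>S \<inter> T. \<exists>N\<in>\<B>. x <# N \<subseteq> S \<inter> T"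
    proof
      fix x assume x: "x \<in> S \<inter> T"
      obtain M N where MN: "M \<in> \<B>" "N \<in> \<B>" "x <# M \<subseteq> S" "x <# N \<subseteq> T"
        using S T x by blast
      then obtain L where "L \<in> \<B>" "L \<subseteq> M \<inter> N"
        using assms unfolding group_nhd_base_def by meson
      then show "\<exists>N\<in>\<B>. x <# N \<subseteq> S \<inter> T"
        using MN unfolding l_coset_def by blast
    qed
  next
    fix \<K> assume K: "\<forall>K\<in>\<K>. ?P K"
    then show "\<Union>\<K> \<subseteq> carrier G" by blast
    show "\<forall>x\<in>\<Union>\<K>. \<exists>N\<in>\<B>. x <# N \<subseteq> \<Union>\<K>"
      using K by (meson Union_iff Union_upper subset_trans)
  qed
  then show ?thesis
    unfolding nhds_topology_def by (simp add: topology_inverse')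
qed

lemma topspace_nhds_topology:
  assumes "group_nhd_base \<B>"
  shows "topspace (nhds_topology \<B>) = carrier G"
proof
  show "topspace (nhds_topology \<B>) \<subseteq> carrier G"
    using openin_topspace openin_nhds_topology[OF assms] by blast
  \<comment> \<open>Openness of the whole group requires some member of \<open>\<B>\<close> to
    translate, hence the nonemptiness axiom.\<close>
  have "openin (nhds_topology \<B>) (carrier G)"
    unfolding openin_nhds_topology[OF assms] using assms l_coset_subset_G
    unfolding group_nhd_base_def by (metis ex_in_conv order_refl)
  then show "carrier G \<subseteq> topspace (nhds_topology \<B>)"
    by (rule openin_subset)
qed

text \<open>Since \<open>N\<close> need not be open, the witness is the interior of
  \<open>x <# N\<close>. It is open because products of elements of a small \<open>L\<close> stay in
  a given \<open>M\<close>, so that every point of \<open>y <# L\<close> is interior whenever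
  \<open>y\<close> is.\<close>

lemma nhds_topology_nhd:
  assumes "group_nhd_base \<B>" "N \<in> \<B>" "x \<in> carrier G"
  obtains U where "openin (nhds_topology \<B>) U" "x \<in> U" "U \<subseteq> x <# N"
proof
  have NG: "\<And>N. N \<in> \<B> \<Longrightarrow> \<one> \<in> N \<and> N \<subseteq> carrier G"
    using assms unfolding group_nhd_base_def by blast
  let ?U = "{y \<in> carrier G. \<exists>M\<in>\<B>. y <# M \<subseteq> x <# N}"
  have self: "y \<in> y <# M" if "M \<in> \<B>" "y \<in> carrier G" for y M
    using NG[OF that(1)] that(2) unfolding l_coset_def by force
  show "x \<in> ?U" using assms by blast
  \<comment> \<open>Each \<open>y\<close> lies in its own translate \<open>y <# M\<close>, as
    \<open>M\<close> contains the identity.\<close>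
  show "?U \<subseteq> x <# N" using self by blast
  show "openin (nhds_topology \<B>) ?U"
    unfolding openin_nhds_topology[OF assms(1)]
  proof (intro conjI ballI)
    show "?U \<subseteq> carrier G" by blast
    fix y assume "y \<in> ?U"
    then obtain M where y: "y \<in> carrier G" and M: "M \<in> \<B>" "y <# M \<subseteq> x <# N" by blast
    obtain L where L: "L \<in> \<B>" "\<And>a b. a \<in> L \<Longrightarrow> b \<in> L \<Longrightarrow> a \<otimes> b \<in> M"
      using group_nhd_base_mult[OF assms(1) M(1)] by blast
    have "(y \<otimes> a) <# L \<subseteq> x <# N" if "a \<in> L" for a
    proof -
      have "(y \<otimes> a) \<otimes> b \<in> x <# N" if "b \<in> L" for b
      proof -
        have "y \<otimes> (a \<otimes> b) \<in> x <# N"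
          using M(2) L(2)[OF \<open>a \<in> L\<close> that] unfolding l_coset_def by blast
        then show ?thesis using NG[OF L(1)] \<open>a \<in> L\<close> that y by (metis m_assoc subsetD)
      qed
      then show ?thesis unfolding l_coset_def by blast
    qed
    moreover have "y \<otimes> a \<in> carrier G" if "a \<in> L" for a
      using NG[OF L(1)] that y by blast
    ultimately have "y <# L \<subseteq> ?U"
      using L(1) unfolding l_coset_def[of G y L] by auto
    then show "\<exists>N\<in>\<B>. y <# N \<subseteq> ?U" using L(1) by blast
  qed
qed

lemma group_topology_nhds_topology:
  assumes "group_nhd_base \<B>"
  shows "group_topology G (nhds_topology \<B>)"
proof -
  let ?T = "nhds_topology \<B>"
  have NG: "\<And>N. N \<in> \<B> \<Longrightarrow> \<one> \<in> N \<and> N \<subseteq> carrier G"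
    using assms unfolding group_nhd_base_def by blast
  note top = topspace_nhds_topology[OF assms]
  have mult: "\<exists>V W. openin ?T V \<and> openin ?T W \<and> x \<in> V \<and> y \<in> W \<and> (\<forall>a\<in>V. \<forall>b\<in>W. a \<otimes> b \<in> U)"
    if U: "openin ?T U" and x: "x \<in> carrier G" and y: "y \<in> carrier G" and xy: "x \<otimes> y \<in> U" for U x y
  proof -
    obtain N where N: "N \<in> \<B>" "(x \<otimes> y) <# N \<subseteq> U"
      using U xy openin_nhds_topology[OF assms] by blast
    obtain M where M: "M \<in> \<B>" "\<And>a b. a \<in> M \<Longrightarrow> b \<in> M \<Longrightarrow> a \<otimes> b \<in> N"
      using group_nhd_base_mult[OF assms N(1)] by blast
    obtain V where V: "openin ?T V" "x \<in> V" "V \<subseteq> x <# M"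
      using nhds_topology_nhd[OF assms M(1) x] by blast
    obtain W where W: "openin ?T W" "y \<in> W" "W \<subseteq> y <# M"
      using nhds_topology_nhd[OF assms M(1) y] by blast
    have "a \<otimes> b \<in> U" if ab: "a \<in> V" "b \<in> W" for a b
    proof -
      obtain m m' where m: "m \<in> M" "m' \<in> M" "a = x \<otimes> m" "b = y \<otimes> m'"
        using ab V W unfolding l_coset_def by blast
      have c: "m \<in> carrier G" "m' \<in> carrier G" using m NG[OF M(1)] by auto
      \<comment> \<open>Commutativity collects the two small factors on the right.\<close>
      have "a \<otimes> b = (x \<otimes> y) \<otimes> (m \<otimes> m')"
        using c x y m by (simp add: m_ac)
      then show ?thesis using N(2) M(2)[OF m(1,2)] unfolding l_coset_def by auto
    qed
    then show ?thesis using V W by blast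
  qed
  have "continuous_map (prod_topology ?T ?T) ?T (\<lambda>(x, y). x \<otimes> y)"
    unfolding continuous_map_def
  proof (intro conjI allI impI)
    show "(\<lambda>(x, y). x \<otimes> y) \<in> topspace (prod_topology ?T ?T) \<rightarrow> topspace ?T"
      by (auto simp: top)
    fix U assume "openin ?T U"
    note mult = mult[OF this]
    show "openin (prod_topology ?T ?T) {z \<in> topspace (prod_topology ?T ?T). (case z of (x, y) \<Rightarrow> x \<otimes> y) \<in> U}"
      unfolding openin_prod_topology_alt
    proof (intro allI impI)
      fix x y
      assume "(x, y) \<in> {z \<in> topspace (prod_topology ?T ?T). (case z of (x, y) \<Rightarrow> x \<otimes> y) \<in> U}"
      then obtain V W where VW: "openin ?T V" "openin ?T W" "x \<in> V" "y \<in> W"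
        "\<forall>a\<in>V. \<forall>b\<in>W. a \<otimes> b \<in> U"
        using mult[of x y] top by auto
      moreover have "V \<subseteq> topspace ?T" "W \<subseteq> topspace ?T"
        using VW openin_subset by blast+
      ultimately show "\<exists>V W. openin ?T V \<and> openin ?T W \<and> x \<in> V \<and> y \<in> W \<and>
          V \<times> W \<subseteq> {z \<in> topspace (prod_topology ?T ?T). (case z of (x, y) \<Rightarrow> x \<otimes> y) \<in> U}"
        by (intro exI[of _ V] exI[of _ W]) auto
    qed
  qed
  moreover have "continuous_map ?T ?T (\<lambda>x. inv x)"
    unfolding continuous_map_def
  proof (intro conjI allI impI)
    show "(\<lambda>x. inv x) \<in> topspace ?T \<rightarrow> topspace ?T"
      by (auto simp: top)
    fix U assume U: "openin ?T U"
    show "openin ?T {x \<in> topspace ?T. inv x \<in> U}"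
      unfolding openin_nhds_topology[OF assms] top
    proof (intro conjI ballI)
      fix x assume x: "x \<in> {x \<in> carrier G. inv x \<in> U}"
      then obtain N where N: "N \<in> \<B>" "inv x <# N \<subseteq> U"
        using U openin_nhds_topology[OF assms] by blast
      obtain M where M: "M \<in> \<B>" "\<And>b. b \<in> M \<Longrightarrow> inv b \<in> N"
        using group_nhd_base_inv[OF assms N(1)] by blast
      have "x \<otimes> m \<in> carrier G \<and> inv (x \<otimes> m) \<in> U" if "m \<in> M" for m
      proof -
        have "m \<in> carrier G" using that NG[OF M(1)] by auto
        moreover have "inv x \<otimes> inv m \<in> U"
          using N(2) M(2)[OF that] unfolding l_coset_def by blast
        ultimately show ?thesis using x by (simp add: inv_mult)
      qed
      then show "\<exists>N\<in>\<B>. x <# N \<subseteq> {x \<in> carrier G. inv x \<in> U}"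
        using M(1) unfolding l_coset_def by blast
    qed blast
  qed
  ultimately show ?thesis
    unfolding group_topology_def top by blast
qed

section \<open>Translations in an arbitrary group topology, and uniqueness of the topology with a
  given base\<close>

text \<open>The translate by \<open>a\<close> is the preimage of \<open>U\<close> under the
  continuous map that multiplies by \<open>inv a\<close>.\<close>

lemma openin_l_coset:
  assumes "group_topology G T" "openin T U" "a \<in> carrier G"
  shows "openin T (a <# U)"
proof -
  have top: "topspace T = carrier G"
    and mult: "continuous_map (prod_topology T T) T (\<lambda>(x, y). x \<otimes> y)"
    using assms unfolding group_topology_def by auto
  have UG: "U \<subseteq> carrier G" using openin_subset[OF assms(2)] top by simp
  have "continuous_map T (prod_topology T T) (\<lambda>x. (inv a, x))"
    using assms(3) by (simp add: continuous_map_pairedI top)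
  from continuous_map_compose[OF this mult]
  have "continuous_map T T (\<lambda>x. inv a \<otimes> x)" by (simp add: o_def)
  then have "openin T {x \<in> topspace T. inv a \<otimes> x \<in> U}"
    using assms(2) openin_continuous_map_preimage by blast
  moreover have "{x \<in> topspace T. inv a \<otimes> x \<in> U} = a <# U"
  proof (intro equalityI subsetI)
    fix x assume "x \<in> {x \<in> topspace T. inv a \<otimes> x \<in> U}"
    then have x: "x \<in> carrier G" "inv a \<otimes> x \<in> U" by (auto simp: top)
    then have "x = a \<otimes> (inv a \<otimes> x)" using assms(3) by (simp add: m_assoc[symmetric])
    then show "x \<in> a <# U" using x unfolding l_coset_def by blast
  next
    fix x assume "x \<in> a <# U"
    then obtain u where u: "u \<in> U" "x = a \<otimes> u" unfolding l_coset_def by blast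
    then have "u \<in> carrier G" using UG by blast
    with u assms(3) show "x \<in> {x \<in> topspace T. inv a \<otimes> x \<in> U}"
      by (simp add: top m_assoc[symmetric])
  qed
  ultimately show ?thesis by simp
qed

text \<open>\<open>\<B>\<close> only has to consist of neighbourhoods of the identity and need not
  be a base. This allows it to be a single subgroup, or the base of a coarser topology.\<close>

lemma openin_if_l_cosets:
  assumes "group_topology G T"
    and nhd: "\<And>N. N \<in> \<B> \<Longrightarrow> \<exists>V. openin T V \<and> \<one> \<in> V \<and> V \<subseteq> N"
    and "U \<subseteq> carrier G" "\<And>x. x \<in> U \<Longrightarrow> \<exists>N\<in>\<B>. x <# N \<subseteq> U"
  shows "openin T U"
proof (subst openin_subopen, intro ballI)
  fix x assume x: "x \<in> U"
  then obtain N where N: "N \<in> \<B>" "x <# N \<subseteq> U" using assms(4) by blast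
  then obtain V where V: "openin T V" "\<one> \<in> V" "V \<subseteq> N" using nhd by blast
  have xG: "x \<in> carrier G" using x assms(3) by blast
  have "openin T (x <# V)" using openin_l_coset assms(1) V(1) xG by blast
  moreover have "x <# V \<subseteq> U" using V(3) N(2) unfolding l_coset_def by blast
  moreover have "x \<in> x <# V" using V(2) xG unfolding l_coset_def by force
  ultimately show "\<exists>W. openin T W \<and> x \<in> W \<and> W \<subseteq> U" by blast
qed

text \<open>Translating \<open>U\<close> by \<open>inv x\<close> moves \<open>x\<close> to the
  identity, where the base applies; translating back gives the claim.\<close>

lemma openin_imp_l_cosets:
  assumes "group_topology G T" "has_nhd_base_at T \<one> \<B>" "openin T U" "x \<in> U"
  shows "\<exists>N\<in>\<B>. x <# N \<subseteq> U"
proof -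
  have UG: "U \<subseteq> carrier G" using openin_subset assms(1,3) unfolding group_topology_def by blast
  then have x: "x \<in> carrier G" using assms(4) by blast
  have "openin T (inv x <# U)" using openin_l_coset assms x by blast
  moreover have "\<one> \<in> inv x <# U" using x assms(4) unfolding l_coset_def by force
  ultimately obtain N where N: "N \<in> \<B>" "N \<subseteq> inv x <# U"
    using assms(2) unfolding has_nhd_base_at_def neighbourhood_base_at_def by meson
  have "x <# N \<subseteq> x <# (inv x <# U)" using N(2) unfolding l_coset_def by blast
  also have "\<dots> = U" using x UG by (simp add: lcos_m_assoc lcos_mult_one)
  finally show ?thesis using N(1) by blast
qed

text \<open>By homogeneity a group topology is determined by its neighbourhoods of the identity.
  This gives the uniqueness behind the definite description in
  \<open>linear_modification\<close>.\<close>

lemma group_topology_eq_nhds_topology: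
  assumes "group_topology G T" "has_nhd_base_at T \<one> \<B>"
  shows "T = nhds_topology \<B>"
proof -
  have "openin T = (\<lambda>U. U \<subseteq> carrier G \<and> (\<forall>x\<in>U. \<exists>N\<in>\<B>. x <# N \<subseteq> U))"
  proof (intro ext iffI conjI ballI)
    fix U assume "openin T U"
    then show "U \<subseteq> carrier G" using openin_subset assms(1) unfolding group_topology_def by blast
  next
    fix U x assume "openin T U" "x \<in> U"
    then show "\<exists>N\<in>\<B>. x <# N \<subseteq> U" using openin_imp_l_cosets assms by blast
  next
    fix U assume "U \<subseteq> carrier G \<and> (\<forall>x\<in>U. \<exists>N\<in>\<B>. x <# N \<subseteq> U)"
    moreover have "\<exists>V. openin T V \<and> \<one> \<in> V \<and> V \<subseteq> N" if "N \<in> \<B>" for N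
      using that assms(2) unfolding has_nhd_base_at_def by blast
    ultimately show "openin T U" using openin_if_l_cosets assms(1) by blast
  qed
  then show ?thesis unfolding nhds_topology_def by (metis openin_inverse)
qed

lemma has_nhd_base_at_nhds_topology:
  assumes "group_nhd_base \<B>"
  shows "has_nhd_base_at (nhds_topology \<B>) \<one> \<B>"
proof -
  let ?T = "nhds_topology \<B>"
  have NG: "\<And>N. N \<in> \<B> \<Longrightarrow> N \<subseteq> carrier G"
    using assms unfolding group_nhd_base_def by blast
  have nhd: "\<exists>U. openin ?T U \<and> \<one> \<in> U \<and> U \<subseteq> N" if "N \<in> \<B>" for N
    using nhds_topology_nhd[OF assms that one_closed] lcos_mult_one[OF NG[OF that]] by metis
  have "\<exists>U V. openin ?T U \<and> V \<in> \<B> \<and> \<one> \<in> U \<and> U \<subseteq> V \<and> V \<subseteq> W"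
    if W: "openin ?T W" "\<one> \<in> W" for W
  proof -
    obtain N where "N \<in> \<B>" "\<one> <# N \<subseteq> W" using W openin_nhds_topology[OF assms] by blast
    then show ?thesis using nhd lcos_mult_one NG by metis
  qed
  then show ?thesis
    unfolding has_nhd_base_at_def neighbourhood_base_at_def topspace_nhds_topology[OF assms]
    using nhd NG by simp
qed

section \<open>Open subgroups and the linear modification\<close>

text \<open>For \<open>x\<close> in \<open>N\<close> the translate \<open>x <# N\<close> stays in
  \<open>N\<close>, so a subgroup that is a neighbourhood of the identity is a neighbourhood of each
  of its points.\<close>

lemma openin_subgroup:
  assumes "group_topology G T" "subgroup N G" "openin T U" "\<one> \<in> U" "U \<subseteq> N"
  shows "openin T N"
proof (rule openin_if_l_cosets[OF assms(1), of "{N}"])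
  show "N \<subseteq> carrier G" using assms(2) by (rule subgroup.subset)
  show "\<exists>M\<in>{N}. x <# M \<subseteq> N" if "x \<in> N" for x
    using that subgroup.m_closed[OF assms(2)] unfolding l_coset_def by blast
qed (use assms in blast)

text \<open>Quotients of elements of a subgroup remain in it, so each member witnesses its own
  quotient condition; intersections of two members are again members.\<close>

lemma group_nhd_base_open_subgroups:
  assumes "group_topology G T"
  shows "group_nhd_base {N. subgroup N G \<and> openin T N}"
  unfolding group_nhd_base_def
proof (intro conjI ballI)
  let ?\<B> = "{N. subgroup N G \<and> openin T N}"
  show "?\<B> \<noteq> {}"
    using assms subgroup_self openin_topspace[of T] unfolding group_topology_def by auto
  show "\<exists>L\<in>?\<B>. L \<subseteq> M \<inter> N" if "M \<in> ?\<B>" "N \<in> ?\<B>" for M N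
    using that subgroups_Inter_pair by blast
  show "\<exists>M\<in>?\<B>. \<forall>a\<in>M. \<forall>b\<in>M. a \<otimes> inv b \<in> N" if "N \<in> ?\<B>" for N
    using that subgroup.m_closed subgroup.m_inv_closed by (metis mem_Collect_eq)
qed (auto simp: subgroup.one_closed dest: subgroup.subset)

lemma linear_modification_eq:
  assumes "group_topology G T"
  shows "linear_modification G T = nhds_topology {N. subgroup N G \<and> openin T N}"
  unfolding linear_modification_def
proof (rule the_equality)
  note base = group_nhd_base_open_subgroups[OF assms]
  let ?\<B> = "{N. subgroup N G \<and> openin T N}"
  show "group_topology G (nhds_topology ?\<B>) \<and> has_nhd_base_at (nhds_topology ?\<B>) \<one> ?\<B>"
    using group_topology_nhds_topology[OF base] has_nhd_base_at_nhds_topology[OF base] ..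
  show "S = nhds_topology ?\<B>" if "group_topology G S \<and> has_nhd_base_at S \<one> ?\<B>" for S
    using that group_topology_eq_nhds_topology by blast
qed

lemma openin_linear_modification_subgroup:
  assumes "group_topology G T" "subgroup N G"
  shows "openin (linear_modification G T) N \<longleftrightarrow> openin T N"
proof -
  let ?\<B> = "{N. subgroup N G \<and> openin T N}"
  note base = group_nhd_base_open_subgroups[OF assms(1)]
  show ?thesis
    unfolding linear_modification_eq[OF assms(1)]
  proof
    assume "openin (nhds_topology ?\<B>) N"
    \<comment> \<open>The subgroups \<open>M\<close> are \<open>T\<close>-open and contain the
      identity, so these translates already make \<open>N\<close> a \<open>T\<close>-neighbourhood
      of each of its points.\<close>
    then have "\<exists>M\<in>?\<B>. x <# M \<subseteq> N" if "x \<in> N" for x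
      using openin_nhds_topology[OF base] that by blast
    then show "openin T N"
      using openin_if_l_cosets[OF assms(1), of ?\<B> N] subgroup.one_closed subgroup.subset[OF assms(2)]
      by blast
  next
    assume "openin T N"
    \<comment> \<open>Conversely \<open>N\<close> itself belongs to the base and serves at each of
      its points.\<close>
    moreover have "x <# N \<subseteq> N" if "x \<in> N" for x
      using that subgroup.m_closed[OF assms(2)] unfolding l_coset_def by blast
    ultimately show "openin (nhds_topology ?\<B>) N"
      unfolding openin_nhds_topology[OF base] using assms(2) subgroup.subset by blast
  qed
qed

text \<open>The topology enters the entropy only through the index set of the supremum, and that set
  is unchanged.\<close>

lemma top_adjoint_entropy_linear_modification:
  assumes "group_topology G T"
  shows "top_adjoint_entropy G (linear_modification G T) \<phi> = top_adjoint_entropy G T \<phi>"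
proof -
  have "open_finite_index_subgroups G (linear_modification G T) = open_finite_index_subgroups G T"
    using openin_linear_modification_subgroup[OF assms]
    unfolding open_finite_index_subgroups_def finite_index_subgroups_def by blast
  then show ?thesis unfolding top_adjoint_entropy_def by simp
qed

section \<open>Sets covering the group by finitely many translates\<close>

text \<open>These are the syndetic sets: the covering condition of
  \<open>totally_bounded_topology\<close>, isolated for a single set.\<close>

definition big_set :: "'a set \<Rightarrow> bool" where
  "big_set U \<longleftrightarrow> (\<exists>F. finite F \<and> F \<subseteq> carrier G \<and> U <#> F = carrier G)"

lemma big_set_mono:
  assumes "big_set U" "U \<subseteq> V" "V \<subseteq> carrier G"
  shows "big_set V"
proof -
  obtain F where F: "finite F" "F \<subseteq> carrier G" "U <#> F = carrier G"
    using assms unfolding big_set_def by blast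
  have "V <#> F \<subseteq> carrier G" using assms(3) F(2) by (rule set_mult_closed)
  moreover have "U <#> F \<subseteq> V <#> F" using assms(2) unfolding set_mult_def by blast
  ultimately show ?thesis using F unfolding big_set_def by blast
qed

text \<open>
  Finitely many pieces \<open>M f \<inter> N g\<close> cover the group; a piece containing \<open>c\<close> lies in the
  translate by \<open>c\<close> of \<open>M M\<^sup>-\<^sup>1 \<inter> N N\<^sup>-\<^sup>1\<close>.
\<close>

lemma big_set_Int:
  assumes "big_set M" "big_set N" "M \<subseteq> carrier G" "N \<subseteq> carrier G"
    and U: "U \<subseteq> carrier G" "\<And>a b. a \<in> M \<Longrightarrow> b \<in> M \<Longrightarrow> a \<otimes> inv b \<in> U"
    and V: "\<And>a b. a \<in> N \<Longrightarrow> b \<in> N \<Longrightarrow> a \<otimes> inv b \<in> V"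
  shows "big_set (U \<inter> V)"
proof -
  obtain F where F: "finite F" "F \<subseteq> carrier G" "M <#> F = carrier G"
    using assms unfolding big_set_def by blast
  obtain H where H: "finite H" "H \<subseteq> carrier G" "N <#> H = carrier G"
    using assms unfolding big_set_def by blast
  define piece where "piece p = (M #> fst p) \<inter> (N #> snd p)" for p
  define c where "c p = (SOME x. x \<in> piece p)" for p
  \<comment> \<open>In a quotient of two elements of the same coset the common factor
    \<open>f\<close> cancels.\<close>
  have diff: "x \<otimes> inv y \<in> W"
    if xy: "x \<in> A #> f" "y \<in> A #> f" and f: "f \<in> carrier G" and A: "A \<subseteq> carrier G"
      and W: "\<And>a b. a \<in> A \<Longrightarrow> b \<in> A \<Longrightarrow> a \<otimes> inv b \<in> W" for x y f A W
  proof -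
    obtain a b where ab: "a \<in> A" "b \<in> A" "x = a \<otimes> f" "y = b \<otimes> f"
      using xy unfolding r_coset_def by blast
    have "a \<in> carrier G" "b \<in> carrier G" using ab A by auto
    then have "x \<otimes> inv y = a \<otimes> inv b"
      using ab f by (simp add: inv_mult m_ac)
    then show ?thesis using W ab by simp
  qed
  have pieceG: "piece p \<subseteq> carrier G" if "p \<in> F \<times> H" for p
  proof -
    have "fst p \<in> carrier G" using that F(2) by auto
    then have "M #> fst p \<subseteq> carrier G" by (rule r_coset_subset_G[OF assms(3)])
    then show ?thesis unfolding piece_def by blast
  qed
  \<comment> \<open>Empty pieces are discarded, since there \<open>c\<close> is an arbitrary value
    that need not lie in the group.\<close>
  let ?K = "c ` {p \<in> F \<times> H. piece p \<noteq> {}}"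
  have cp: "c p \<in> piece p" if "piece p \<noteq> {}" for p
    using that unfolding c_def by (simp add: some_in_eq)
  have fin: "finite ?K" using F(1) H(1) by simp
  have KG: "?K \<subseteq> carrier G" using pieceG cp by blast
  have "carrier G \<subseteq> (U \<inter> V) <#> ?K"
  proof
    fix x assume x: "x \<in> carrier G"
    obtain f h where fh: "f \<in> F" "h \<in> H" "x \<in> piece (f, h)"
      using eqset_imp_iff[OF F(3), of x] eqset_imp_iff[OF H(3), of x] x
      unfolding piece_def set_mult_def r_coset_def by auto
    let ?c = "c (f, h)"
    have c: "?c \<in> piece (f, h)" using cp fh(3) by blast
    then have cK: "?c \<in> ?K" using fh by blast
    have fhG: "f \<in> carrier G" "h \<in> carrier G" using fh F(2) H(2) by auto
    have "x \<otimes> inv ?c \<in> U"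
      using diff[of x M f ?c U] fh(3) c fhG(1) assms(3) U(2) unfolding piece_def by auto
    moreover have "x \<otimes> inv ?c \<in> V"
      using diff[of x N h ?c V] fh(3) c fhG(2) assms(4) V unfolding piece_def by auto
    moreover have "x = (x \<otimes> inv ?c) \<otimes> ?c"
      using x subsetD[OF KG cK] by (simp add: m_assoc)
    ultimately show "x \<in> (U \<inter> V) <#> ?K"
      using cK unfolding set_mult_def by blast
  qed
  moreover have "(U \<inter> V) <#> ?K \<subseteq> carrier G"
    using U(1) KG by (intro set_mult_closed) auto
  ultimately show ?thesis using fin KG unfolding big_set_def by blast
qed

text \<open>Choosing one representative per coset gives a finite \<open>F\<close>, and the cosets
  cover the group.\<close>

lemma big_set_finite_index:
  assumes "N \<in> finite_index_subgroups G"
  shows "big_set N"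
proof -
  have N: "subgroup N G" "finite (rcosets N)"
    using assms unfolding finite_index_subgroups_def by auto
  have img: "rcosets N = (\<lambda>a. N #> a) ` carrier G"
    unfolding RCOSETS_def by blast
  obtain F where F: "F \<subseteq> carrier G" "finite F" "rcosets N = (\<lambda>a. N #> a) ` F"
    using finite_subset_image[OF N(2), of "\<lambda>a. N #> a" "carrier G"] img by auto
  have "N <#> F = \<Union>(rcosets N)"
    unfolding F(3) set_mult_def r_coset_def by blast
  also have "\<dots> = carrier G" using rcosets_part_G N(1) by blast
  finally show ?thesis using F unfolding big_set_def by blast
qed

\<comment> \<open>The identity neighbourhoods of the Bohr modification\<close>
\<comment> \<open>Membership amounts to an infinite chain of big open sets around the identity
  starting at \<open>U\<close>, the quotients of each set lying in the previous one. The greatest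
  fixed point is essential: the rule has no base case, so the least one is empty.\<close>
coinductive_set bohr_nhds :: "'a topology \<Rightarrow> 'a set set" for T where
  bohr_nhdsI: "\<lbrakk>openin T U; \<one> \<in> U; big_set U; M \<in> bohr_nhds T;
    \<forall>a\<in>M. \<forall>b\<in>M. a \<otimes> inv b \<in> U\<rbrakk> \<Longrightarrow> U \<in> bohr_nhds T"

text \<open>Coinduction on the family \<open>X\<close> of pairwise intersections. Two big sets may
  have a small intersection, so bigness of \<open>U \<inter> V\<close> is drawn from the sets
  \<open>M\<close> and \<open>N\<close> one level down the chains via \<open>big_set_Int\<close>;
  \<open>M \<inter> N\<close> continues the chain.\<close>

lemma bohr_nhds_Int:
  assumes "group_topology G T" "U \<in> bohr_nhds T" "V \<in> bohr_nhds T"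
  shows "U \<inter> V \<in> bohr_nhds T"
proof -
  define X where "X W \<longleftrightarrow> (\<exists>U\<in>bohr_nhds T. \<exists>V\<in>bohr_nhds T. W = U \<inter> V)" for W
  have "X (U \<inter> V)" using assms X_def by blast
  then show ?thesis
  proof (rule bohr_nhds.coinduct)
    fix W assume "X W"
    then obtain U V where W: "U \<in> bohr_nhds T" "V \<in> bohr_nhds T" "W = U \<inter> V"
      unfolding X_def by blast
    obtain M where M: "openin T U" "\<one> \<in> U" "M \<in> bohr_nhds T" "\<forall>a\<in>M. \<forall>b\<in>M. a \<otimes> inv b \<in> U"
      using W(1) by (cases rule: bohr_nhds.cases) auto
    obtain N where N: "openin T V" "\<one> \<in> V" "N \<in> bohr_nhds T" "\<forall>a\<in>N. \<forall>b\<in>N. a \<otimes> inv b \<in> V"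
      using W(2) by (cases rule: bohr_nhds.cases) auto
    have sub: "A \<subseteq> carrier G" if "openin T A" for A
      using openin_subset[OF that] assms(1) unfolding group_topology_def by simp
    have "big_set M" "openin T M" "big_set N" "openin T N"
      using M(3) N(3) by (auto elim: bohr_nhds.cases)
    then have "big_set (U \<inter> V)"
      using big_set_Int[of M N U V] M N sub by blast
    moreover have "X (M \<inter> N)" using M(3) N(3) unfolding X_def by blast
    moreover have "\<forall>a\<in>M \<inter> N. \<forall>b\<in>M \<inter> N. a \<otimes> inv b \<in> W" using M N W(3) by blast
    ultimately show "\<exists>U M. W = U \<and> openin T U \<and> \<one> \<in> U \<and> big_set U \<and>
        (X M \<or> M \<in> bohr_nhds T) \<and> (\<forall>a\<in>M. \<forall>b\<in>M. a \<otimes> inv b \<in> U)"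
      using M(1,2) N(1,2) W(3) by blast
  qed
qed

text \<open>The open finite-index subgroups form a family closed under the coinductive rule, each
  taking itself as the next set of the chain.\<close>

lemma finite_index_in_bohr_nhds:
  assumes "N \<in> open_finite_index_subgroups G T"
  shows "N \<in> bohr_nhds T"
  using assms
proof (coinduction arbitrary: N rule: bohr_nhds.coinduct)
  case (bohr_nhds N)
  then have N: "subgroup N G" "openin T N" "big_set N"
    using big_set_finite_index
    unfolding open_finite_index_subgroups_def finite_index_subgroups_def by auto
  have "\<forall>a\<in>N. \<forall>b\<in>N. a \<otimes> inv b \<in> N"
    using N(1) subgroup.m_closed subgroup.m_inv_closed by metis
  then show ?case using N bohr_nhds subgroup.one_closed by blast
qed

lemma group_nhd_base_bohr_nhds:
  assumes "group_topology G T"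
  shows "group_nhd_base (bohr_nhds T)"
proof -
  \<comment> \<open>The whole group has a single coset, which shows that the family is
    nonempty.\<close>
  have "carrier G \<in> open_finite_index_subgroups G T"
  proof -
    have "rcosets (carrier G) = {carrier G}"
      unfolding RCOSETS_def using coset_join2[OF _ subgroup_self] one_closed by blast
    then show ?thesis
      using assms subgroup_self openin_topspace[of T]
      unfolding open_finite_index_subgroups_def finite_index_subgroups_def group_topology_def by auto
  qed
  then have ne: "bohr_nhds T \<noteq> {}" using finite_index_in_bohr_nhds by blast
  have "\<one> \<in> N \<and> N \<subseteq> carrier G" if "N \<in> bohr_nhds T" for N
    using that openin_subset[of T N] assms unfolding group_topology_def
    by (cases rule: bohr_nhds.cases) auto
  moreover have "\<exists>M\<in>bohr_nhds T. \<forall>a\<in>M. \<forall>b\<in>M. a \<otimes> inv b \<in> N" if "N \<in> bohr_nhds T" for N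
    using that by (cases rule: bohr_nhds.cases) auto
  moreover have "\<exists>L\<in>bohr_nhds T. L \<subseteq> M \<inter> N" if "M \<in> bohr_nhds T" "N \<in> bohr_nhds T" for M N
    using bohr_nhds_Int[OF assms that] by blast
  ultimately show ?thesis
    unfolding group_nhd_base_def using ne by simp
qed

text \<open>This is the maximality behind "finest". The \<open>R\<close>-open sets around the
  identity form a family closed under the coinductive rule: total boundedness makes them big, and
  continuity of the group operations supplies the next set.\<close>

lemma totally_bounded_nhds_in_bohr_nhds:
  assumes R: "group_topology G R" "totally_bounded_topology G R" "coarser_topology R T"
    and "openin R U" "\<one> \<in> U"
  shows "U \<in> bohr_nhds T"
  using assms(4,5)
proof (coinduction arbitrary: U rule: bohr_nhds.coinduct)
  case (bohr_nhds U)
  have top: "topspace R = carrier G"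
    and mult: "continuous_map (prod_topology R R) R (\<lambda>(x, y). x \<otimes> y)"
    and inv: "continuous_map R R (\<lambda>x. inv x)"
    using R(1) unfolding group_topology_def by auto
  have "continuous_map (prod_topology R R) (prod_topology R R) (\<lambda>z. (fst z, inv (snd z)))"
    using inv by (intro continuous_map_pairedI continuous_map_fst
        continuous_map_compose[OF continuous_map_snd inv, unfolded o_def])
  from continuous_map_compose[OF this mult]
  have "continuous_map (prod_topology R R) R (\<lambda>z. fst z \<otimes> inv (snd z))"
    by (simp add: o_def)
  then have "openin (prod_topology R R)
      {z \<in> topspace (prod_topology R R). fst z \<otimes> inv (snd z) \<in> U}"
    using bohr_nhds(1) openin_continuous_map_preimage by blast
  moreover have "(\<one>, \<one>) \<in> {z \<in> topspace (prod_topology R R). fst z \<otimes> inv (snd z) \<in> U}"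
    using bohr_nhds(2) top by simp
  ultimately obtain V W where VW: "openin R V" "openin R W" "\<one> \<in> V" "\<one> \<in> W"
    "V \<times> W \<subseteq> {z \<in> topspace (prod_topology R R). fst z \<otimes> inv (snd z) \<in> U}"
    unfolding openin_prod_topology_alt by meson
  \<comment> \<open>\<open>V\<close> and \<open>W\<close> come from continuity of the quotient map
    at the pair of identities; their intersection serves both arguments.\<close>
  have "\<forall>a\<in>V \<inter> W. \<forall>b\<in>V \<inter> W. a \<otimes> inv b \<in> U" using VW(5) by auto
  moreover have "big_set U"
    using bohr_nhds R(2) unfolding totally_bounded_topology_def big_set_def by blast
  ultimately show ?case
    using bohr_nhds VW R(3) unfolding coarser_topology_def by blast
qed

section \<open>Identification of the Bohr modification and comparison of entropies\<close>

text \<open>Total boundedness holds because members of \<open>bohr_nhds T\<close> are big,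
  coarseness because they are \<open>T\<close>-open, and maximality by the preceding
  coinduction.\<close>

lemma is_bohr_modification_nhds_topology:
  assumes "group_topology G T"
  shows "is_bohr_modification G T (nhds_topology (bohr_nhds T))"
  unfolding is_bohr_modification_def
proof (intro conjI allI impI)
  let ?S = "nhds_topology (bohr_nhds T)"
  note base = group_nhd_base_bohr_nhds[OF assms]
  show "group_topology G ?S" by (rule group_topology_nhds_topology[OF base])
  show "totally_bounded_topology G ?S"
    unfolding totally_bounded_topology_def
  proof (intro allI impI)
    fix U assume U: "openin ?S U \<and> \<one> \<in> U"
    then obtain N where N: "N \<in> bohr_nhds T" "\<one> <# N \<subseteq> U" and UG: "U \<subseteq> carrier G"
      using openin_nhds_topology[OF base] by blast
    have "N \<subseteq> carrier G" using N(1) base unfolding group_nhd_base_def by blast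
    then have "N \<subseteq> U" using N(2) lcos_mult_one by auto
    moreover have "big_set N" using N(1) by (auto elim: bohr_nhds.cases)
    ultimately show "\<exists>F. finite F \<and> F \<subseteq> carrier G \<and> U <#> F = carrier G"
      using big_set_mono UG unfolding big_set_def by blast
  qed
  show "coarser_topology ?S T"
    unfolding coarser_topology_def
  proof (intro allI impI)
    fix U assume "openin ?S U"
    then have U: "U \<subseteq> carrier G" "\<And>x. x \<in> U \<Longrightarrow> \<exists>N\<in>bohr_nhds T. x <# N \<subseteq> U"
      using openin_nhds_topology[OF base] by auto
    show "openin T U"
      using openin_if_l_cosets[OF assms _ U] by (blast elim: bohr_nhds.cases)
  qed
  fix R assume R: "group_topology G R \<and> totally_bounded_topology G R \<and> coarser_topology R T"
  show "coarser_topology R ?S"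
    unfolding coarser_topology_def openin_nhds_topology[OF base]
  proof (intro allI impI conjI ballI)
    fix U assume U: "openin R U"
    then show UG: "U \<subseteq> carrier G"
      using openin_subset R unfolding group_topology_def by blast
    fix x assume x: "x \<in> U"
    then have xG: "x \<in> carrier G" using UG by blast
    have "openin R (inv x <# U)" using openin_l_coset R U xG by blast
    moreover have "\<one> \<in> inv x <# U" using x xG unfolding l_coset_def by force
    \<comment> \<open>The shifted set is itself a member of the base, and shifting it back returns
      exactly \<open>U\<close>.\<close>
    ultimately have "inv x <# U \<in> bohr_nhds T"
      using totally_bounded_nhds_in_bohr_nhds R by blast
    moreover have "x <# (inv x <# U) = U"
      using xG UG by (simp add: lcos_m_assoc lcos_mult_one)
    ultimately show "\<exists>N\<in>bohr_nhds T. x <# N \<subseteq> U" by (metis order_refl)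
  qed
qed

lemma bohr_modification_eq:
  assumes "group_topology G T"
  shows "bohr_modification G T = nhds_topology (bohr_nhds T)"
  unfolding bohr_modification_def
proof (rule the_equality)
  show *: "is_bohr_modification G T (nhds_topology (bohr_nhds T))"
    by (rule is_bohr_modification_nhds_topology[OF assms])
  fix S assume "is_bohr_modification G T S"
  \<comment> \<open>Two finest topologies are each coarser than the other, hence equal.\<close>
  with * show "S = nhds_topology (bohr_nhds T)"
    unfolding is_bohr_modification_def coarser_topology_def topology_eq by blast
qed

lemma group_topology_bohr_modification:
  assumes "group_topology G T"
  shows "group_topology G (bohr_modification G T)"
  unfolding bohr_modification_eq[OF assms]
  by (rule group_topology_nhds_topology[OF group_nhd_base_bohr_nhds[OF assms]])

lemma top_adjoint_entropy_bohr_modification: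
  assumes "group_topology G T"
  shows "top_adjoint_entropy G (bohr_modification G T) \<phi> = top_adjoint_entropy G T \<phi>"
proof -
  have "openin (bohr_modification G T) N \<longleftrightarrow> openin T N" if N: "N \<in> finite_index_subgroups G" for N
  proof
    show "openin (bohr_modification G T) N \<Longrightarrow> openin T N"
      using is_bohr_modification_nhds_topology[OF assms]
      unfolding bohr_modification_eq[OF assms] is_bohr_modification_def coarser_topology_def by blast
    assume "openin T N"
    then have "N \<in> bohr_nhds T"
      using N finite_index_in_bohr_nhds unfolding open_finite_index_subgroups_def by blast
    \<comment> \<open>Membership in \<open>bohr_nhds T\<close> makes \<open>N\<close> only a
      neighbourhood of the identity in the Bohr modification; being a subgroup then makes it
      open.\<close>
    then obtain U where "openin (bohr_modification G T) U" "\<one> \<in> U" "U \<subseteq> N"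
      using has_nhd_base_at_nhds_topology[OF group_nhd_base_bohr_nhds[OF assms]]
      unfolding bohr_modification_eq[OF assms] has_nhd_base_at_def by blast
    then show "openin (bohr_modification G T) N"
      using openin_subgroup[OF group_topology_bohr_modification[OF assms]] N
      unfolding finite_index_subgroups_def by blast
  qed
  then have "open_finite_index_subgroups G (bohr_modification G T) = open_finite_index_subgroups G T"
    unfolding open_finite_index_subgroups_def by blast
  then show ?thesis unfolding top_adjoint_entropy_def by simp
qed

end

theorem proposition4p10:
  fixes G :: "('a, 'b) monoid_scheme" and \<tau> :: "'a topology" and \<phi> :: "'a \<Rightarrow> 'a"
  assumes "comm_group G"
    and "group_topology G \<tau>"
    and "\<phi> \<in> hom G G"
    and "continuous_map \<tau> \<tau> \<phi>"
  shows "top_adjoint_entropy G \<tau> \<phi> = top_adjoint_entropy G (linear_modification G \<tau>) \<phi> \<and>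
    top_adjoint_entropy G (linear_modification G \<tau>) \<phi> =
      top_adjoint_entropy G (bohr_modification G \<tau>) \<phi> \<and>
    top_adjoint_entropy G (bohr_modification G \<tau>) \<phi> =
      top_adjoint_entropy G (linear_modification G (bohr_modification G \<tau>)) \<phi>"
proof -
  interpret comm_group G by fact
  show ?thesis
    \<comment> \<open>The last equality applies the result on linear modifications to the Bohr
      modification, which must therefore be known to be a group topology.\<close>
    using assms(2) group_topology_bohr_modification[OF assms(2)]
    by (simp add: top_adjoint_entropy_linear_modification top_adjoint_entropy_bohr_modification)
qed

end
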